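(* Let $\vec\alpha=(\alpha_1,\alpha_2,\alpha_3)$ and $\vec\beta=(\alpha_4,\alpha_5,\alpha_6)$ be vectors in Euclidean space $\mathbb{R}^3$ with $|\vec\alpha|=1$, and let $\beta:=|\vec\beta|$. Let $$\gamma(\vec\alpha,\vec\beta;t)=\exp\left(t\sum_{i=1}^6\alpha_ie_i\right)\exp\left(-t\sum_{i=4}^6\alpha_ie_i\right),\quad t\in\mathbb{R},$$ be the corresponding arclength-parametrized geodesic of $(\mathrm{SL}(2,\mathbb{C}),\rho)$. Suppose $\beta>1$ and $\vec\alpha\cdot\vec\beta=0$. If the segment $\gamma(t)$, $0\le t\le T$, of the geodesic $\gamma(\vec\alpha,\vec\beta;t)$ is a shortest arc, then $T\le\frac{2\pi}{\sqrt{\beta^2-1}}$.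
   Context: Let $e_1=\frac12\begin{pmatrix}0&1\\1&0\end{pmatrix}$, $e_2=\frac12\begin{pmatrix}0&\mathbf{i}\\-\mathbf{i}&0\end{pmatrix}$, $e_3=\frac12\begin{pmatrix}1&0\\0&-1\end{pmatrix}$, $e_4=\mathbf{i}e_1$, $e_5=\mathbf{i}e_2$, $e_6=\mathbf{i}e_3$ (a real basis of $\mathfrak{sl}(2,\mathbb{C})$). $H_0=\mathrm{span}_{\mathbb{R}}(e_1,e_2,e_3)$ with scalar product $(\cdot,\cdot)$ for which $e_1,e_2,e_3$ are orthonormal. The left-invariant sub-Riemannian metric $\rho$ on $\mathrm{SL}(2,\mathbb{C})$: $\rho(x,y)$ is the infimum of lengths $\int_0^a\sqrt{(u,u)}\,dt$ of piecewise continuously differentiable paths from $x$ to $y$ with $\gamma'(t)=dl_{\gamma(t)}(u(t))$, $u(t)\in H_0$, where $l_g:h\mapsto gh$. A shortest arc is a horizontal ($u(t)\in H_0$) curve whose length equals the $\rho$-distance between its endpoints; a geodesic is a curve that is locally a shortest arc. The arclength-parametrized geodesics starting at the unit are the curves $\gamma(\vec\alpha,\vec\beta;\cdot)$ with $|\vec\alpha|=1$. *)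

theory Defs
  imports "HOL-Analysis.Analysis"
begin

type_synonym mat2 = "complex^2^2"

subsection \<open>Matrix exponential\<close>

text \<open>The multiplication that the type class \<open>times\<close> provides on vectors acts componentwise,
  so powers and the exponential are introduced here for the matrix product.\<close>

primrec mpow :: "mat2 \<Rightarrow> nat \<Rightarrow> mat2" where
  "mpow A 0 = mat 1"
| "mpow A (Suc n) = A ** mpow A n"

definition mexp :: "mat2 \<Rightarrow> mat2" where
  "mexp A = (\<Sum>n. (1 / fact n :: real) *\<^sub>R mpow A n)"

definition SL2C :: "mat2 set" where
  "SL2C = {A. det A = 1}"

subsection \<open>The real basis of the Lie algebra and the horizontal subspace\<close>

definition e1 :: mat2 where
  "e1 = (1/2::real) *\<^sub>R vector [vector [0, 1], vector [1, 0]]"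

definition e2 :: mat2 where
  "e2 = (1/2::real) *\<^sub>R vector [vector [0, \<i>], vector [- \<i>, 0]]"

definition e3 :: mat2 where
  "e3 = (1/2::real) *\<^sub>R vector [vector [1, 0], vector [0, - 1]]"

definition e4 :: mat2 where "e4 = (\<chi> i j. \<i> * e1 $ i $ j)"
definition e5 :: mat2 where "e5 = (\<chi> i j. \<i> * e2 $ i $ j)"
definition e6 :: mat2 where "e6 = (\<chi> i j. \<i> * e3 $ i $ j)"

definition H0 :: "mat2 set" where
  "H0 = span {e1, e2, e3}"

text \<open>\<^term>\<open>representation {e1, e2, e3} X b\<close> is the real coordinate of \<open>X\<close> at the
  basis vector \<open>b\<close>, so this is the scalar product on \<^const>\<open>H0\<close> that makes
  \<open>e1, e2, e3\<close> orthonormal; outside \<^const>\<open>H0\<close> its value is meaningless.\<close>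

definition H0_inner :: "mat2 \<Rightarrow> mat2 \<Rightarrow> real" where
  "H0_inner X Y =
     (\<Sum>b\<in>{e1, e2, e3}. representation {e1, e2, e3} X b * representation {e1, e2, e3} Y b)"

lemma e_distinct: "e1 \<noteq> e2" "e1 \<noteq> e3" "e2 \<noteq> e3"
  by (auto simp: e1_def e2_def e3_def vec_eq_iff forall_2 complex_eq_iff)

lemma independent_e: "independent {e1, e2, e3}"
proof -
  have "u e1 = 0 \<and> u e2 = 0 \<and> u e3 = 0" if "(\<Sum>v\<in>{e1, e2, e3}. u v *\<^sub>R v) = 0" for u
  proof -
    have "u e1 *\<^sub>R e1 + u e2 *\<^sub>R e2 + u e3 *\<^sub>R e3 = 0"
      using that e_distinct by (simp add: add.assoc)
    then have "u e1 *\<^sub>R e1 $ i $ j + u e2 *\<^sub>R e2 $ i $ j + u e3 *\<^sub>R e3 $ i $ j = 0" for i j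
      by (simp add: vec_eq_iff)
    from this[of 1 1] this[of 1 2] show ?thesis
      by (simp add: e1_def e2_def e3_def complex_eq_iff)
  qed
  then show ?thesis
    using real_vector.dependent_finite[of "{e1, e2, e3}"] by blast
qed

lemma H0_inner_orthonormal:
  assumes "a \<in> {e1, e2, e3}" "b \<in> {e1, e2, e3}"
  shows "H0_inner a b = (if a = b then 1 else 0)"
  using assms e_distinct
  by (auto simp: H0_inner_def representation_basis[OF independent_e])

subsection \<open>Horizontal paths and the sub-Riemannian metric\<close>

text \<open>One-sided derivatives at the break points are required to exist and to be continuous on
  the closed pieces. The weaker library notion \<^const>\<open>piecewise_C1_differentiable_on\<close> allows
  derivatives that are unbounded, and even not integrable, near a break point.\<close>

definition piecewise_C1_path :: "(real \<Rightarrow> mat2) \<Rightarrow> real \<Rightarrow> real \<Rightarrow> bool" where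
  "piecewise_C1_path \<gamma> a b \<longleftrightarrow>
     (\<exists>(n::nat) p. p 0 = a \<and> p n = b \<and> (\<forall>i<n. p i < p (Suc i)) \<and>
        (\<forall>i<n. \<exists>D. continuous_on {p i..p (Suc i)} D \<and>
           (\<forall>t\<in>{p i..p (Suc i)}. (\<gamma> has_vector_derivative D t) (at t within {p i..p (Suc i)}))))"

text \<open>The differential of the left translation \<open>h \<mapsto> g h\<close> sends \<open>u\<close> to the matrix product of
  \<open>g\<close> and \<open>u\<close>. The velocity equation is not imposed at finitely many times, which absorbs the
  break points of \<open>\<gamma>\<close>; elsewhere it determines the control \<open>u\<close>.\<close>

definition horizontal_path :: "(real \<Rightarrow> mat2) \<Rightarrow> (real \<Rightarrow> mat2) \<Rightarrow> real \<Rightarrow> real \<Rightarrow> bool" where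
  "horizontal_path \<gamma> u a b \<longleftrightarrow>
     a \<le> b \<and> piecewise_C1_path \<gamma> a b \<and> (\<forall>t\<in>{a..b}. \<gamma> t \<in> SL2C) \<and>
     (\<exists>S. finite S \<and> (\<forall>t\<in>{a..b} - S.
        u t \<in> H0 \<and> (\<gamma> has_vector_derivative (\<gamma> t ** u t)) (at t)))"

definition control_length :: "(real \<Rightarrow> mat2) \<Rightarrow> real \<Rightarrow> real \<Rightarrow> real" where
  "control_length u a b = integral {a..b} (\<lambda>t. sqrt (H0_inner (u t) (u t)))"

text \<open>Any two points of \<^const>\<open>SL2C\<close> are joined by a horizontal path, so the infimum below is
  taken over a nonempty set of nonnegative reals.\<close>

definition sr_dist :: "mat2 \<Rightarrow> mat2 \<Rightarrow> real" where
  "sr_dist x y =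
     Inf {control_length u 0 a | \<gamma> u a. horizontal_path \<gamma> u 0 a \<and> \<gamma> 0 = x \<and> \<gamma> a = y}"

definition shortest_arc :: "(real \<Rightarrow> mat2) \<Rightarrow> real \<Rightarrow> real \<Rightarrow> bool" where
  "shortest_arc \<gamma> a b \<longleftrightarrow>
     (\<exists>u. horizontal_path \<gamma> u a b \<and> control_length u a b = sr_dist (\<gamma> a) (\<gamma> b))"

text \<open>The components of \<open>\<beta>\<close> are the coefficients \<open>\<alpha>\<^sub>4, \<alpha>\<^sub>5, \<alpha>\<^sub>6\<close>.\<close>

definition sr_geodesic :: "real^3 \<Rightarrow> real^3 \<Rightarrow> real \<Rightarrow> mat2" where
  "sr_geodesic \<alpha> \<beta> t =
     mexp (t *\<^sub>R (\<alpha>$1 *\<^sub>R e1 + \<alpha>$2 *\<^sub>R e2 + \<alpha>$3 *\<^sub>R e3 + \<beta>$1 *\<^sub>R e4 + \<beta>$2 *\<^sub>R e5 + \<beta>$3 *\<^sub>R e6)) **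
     mexp (- t *\<^sub>R (\<beta>$1 *\<^sub>R e4 + \<beta>$2 *\<^sub>R e5 + \<beta>$3 *\<^sub>R e6))"

end

theory Submission
  imports Defs
begin

text \<open>Put \<open>h = 1 / sqrt (|\<beta>|\<^sup>2 - 1)\<close>, \<open>k = sqrt (1 + h\<^sup>2)\<close> and \<open>n = \<beta> / |\<beta>|\<close>, so that
  \<open>\<beta> = (k / h) n\<close>. The bound \<open>2 \<pi> h\<close> is half the period of the first exponential factor
  as a function of \<open>t\<close>.

  Let \<open>P\<close> be twice the Hermitian matrix with coordinates \<open>\<alpha>\<close>, and \<open>N\<close> be \<open>2\<i>\<close> times the one with
  coordinates \<open>n\<close>. Then \<open>P\<^sup>2 = 1\<close>, \<open>N\<^sup>2 = -1\<close> and, as \<open>\<alpha>\<close> and \<open>n\<close> are orthogonal, \<open>P N = - N P\<close>. Both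
  exponentials have exponents proportional to a square root of \<open>-1\<close>, and identifying \<open>x + y N\<close> with
  the complex number \<open>z = x + \<i> y\<close> gives
  \<open>\<gamma>(2 h \<tau>) = p + P q\<close> with
  \<open>p = (cos \<tau> + \<i> k sin \<tau>) exp(- \<i> k \<tau>)\<close> and \<open>q = h sin \<tau> exp(- \<i> k \<tau>)\<close>.
  Turning \<open>\<alpha>\<close> about \<open>n\<close> by a suitable angle multiplies \<open>q\<close> by an arbitrary phase and leaves \<open>p\<close>
  alone. Hence two geodesics with the same \<open>n\<close> can be made to meet once \<open>p\<close> and \<open>|q|\<close> agree.

  Geometrically, \<open>P\<close>, \<open>N\<close> and \<open>P N\<close> span a copy of \<open>su(1,1)\<close>. The geodesic projects to a circle of
  radius \<open>R\<close> in the hyperbolic plane, where \<open>h = sinh R\<close> and \<open>k = cosh R\<close>, \<open>|q|\<close> encodes the distance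
  from the start and the argument of \<open>p\<close> encodes the enclosed area. A path that overshoots the
  full circle by a small angle \<open>2 \<theta>\<close> is beaten by an arc of a slightly larger circle that falls
  short of a full turn but has the same chord and area. Analytically, replace
  \<open>\<tau> = \<pi> + \<theta>\<close> by \<open>\<tau> = \<pi> - \<theta>'\<close> and \<open>h\<close> by a larger \<open>h'\<close> with \<open>h' sin \<theta>' = h sin \<theta>\<close>. Up to a
  common sign, the two values of \<open>p\<close> have the arguments \<open>- k \<pi>\<close> and \<open>- k' \<pi>\<close> of full circles, with
  errors of order \<open>\<theta>\<^sup>3\<close>. By the intermediate value theorem they can be matched by a change of \<open>h\<close> that is too
  small to use up the gain in length, which is linear in \<open>\<theta>\<close>. That is
  \<open>compensating_parameter\<close>, and \<open>geodesics_meet\<close> turns it into a second geodesic to the same point.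

  If \<open>T > 2 \<pi> h\<close>, some point strictly before time \<open>T\<close> is thus reached by a shorter path. Following
  the original geodesic from there on contradicts minimality, since the geodesic has unit
  speed and length \<open>T\<close>.\<close>

section \<open>Square roots of minus one among the matrices\<close>

lemma matrix_mult_scaleR:
  fixes A B :: mat2
  shows "(r *\<^sub>R A) ** B = r *\<^sub>R (A ** B)" and "A ** (r *\<^sub>R B) = r *\<^sub>R (A ** B)"
  by (simp_all add: matrix_matrix_mult_def vec_eq_iff forall_2 sum_2 algebra_simps)

lemma matrix_mult_diff:
  fixes A B C :: mat2
  shows "(A - B) ** C = A ** C - B ** C" and "C ** (A - B) = C ** A - C ** B"
  by (simp_all add: matrix_matrix_mult_def vec_eq_iff forall_2 sum_2 algebra_simps)

lemma matrix_mult_uminus: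
  fixes A B :: mat2
  shows "(- A) ** B = - (A ** B)" and "A ** (- B) = - (A ** B)"
  by (simp_all add: matrix_matrix_mult_def vec_eq_iff forall_2 sum_2 algebra_simps)

lemma matrix_mult_add_rdistrib:
  fixes A B C :: mat2
  shows "(A + B) ** C = A ** C + B ** C"
  by (simp_all add: matrix_matrix_mult_def vec_eq_iff forall_2 sum_2 algebra_simps)

lemmas matrix_expand = matrix_add_ldistrib matrix_mult_add_rdistrib matrix_mult_scaleR
  matrix_mult_uminus matrix_mult_diff matrix_mul_lid matrix_mul_rid

lemma bounded_bilinear_matrix_mult: "bounded_bilinear ((**) :: mat2 \<Rightarrow> mat2 \<Rightarrow> mat2)"
proof -
  have "bilinear ((**) :: mat2 \<Rightarrow> mat2 \<Rightarrow> mat2)"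
    by (auto simp: bilinear_def linear_iff matrix_expand)
  then show ?thesis
    by (simp add: bilinear_conv_bounded_bilinear)
qed

text \<open>When \<open>J\<^sup>2 = -1\<close>, this embeds the complex numbers as a subring that sends \<open>\<i>\<close> to \<open>J\<close>.\<close>

definition complex_mat :: "mat2 \<Rightarrow> complex \<Rightarrow> mat2" where
  "complex_mat J z = Re z *\<^sub>R mat 1 + Im z *\<^sub>R J"

lemma complex_mat_mult:
  assumes "J ** J = - mat 1"
  shows "complex_mat J a ** complex_mat J b = complex_mat J (a * b)"
  by (simp add: complex_mat_def matrix_expand assms algebra_simps)

text \<open>Euler's formula: the powers of \<open>J\<close> repeat with period four, so the exponential series splits
  into the cosine and the sine series.\<close>

lemma mexp_square_root_of_minus_one:
  assumes "J ** J = - mat 1"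
  shows "mexp (x *\<^sub>R J) = complex_mat J (cis x)"
proof -
  have pow: "(1 / fact n :: real) *\<^sub>R mpow (x *\<^sub>R J) n
      = (cos_coeff n * x ^ n) *\<^sub>R mat 1 + (sin_coeff n * x ^ n) *\<^sub>R J" for n
  proof (induction n)
    case 0
    then show ?case by simp
  next
    case (Suc n)
    have "(1 / fact (Suc n) :: real) *\<^sub>R mpow (x *\<^sub>R J) (Suc n)
        = (x / Suc n) *\<^sub>R (J ** ((1 / fact n :: real) *\<^sub>R mpow (x *\<^sub>R J) n))"
      by (simp add: matrix_expand field_simps)
    also have "\<dots> = (cos_coeff (Suc n) * x ^ Suc n) *\<^sub>R mat 1
        + (sin_coeff (Suc n) * x ^ Suc n) *\<^sub>R J"
      unfolding Suc.IH
      by (simp add: matrix_expand assms cos_coeff_Suc sin_coeff_Suc scaleR_right_diff_distrib mult_ac)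
    finally show ?case .
  qed
  have "(\<lambda>n. (cos_coeff n * x ^ n) *\<^sub>R (mat 1 :: mat2) + (sin_coeff n * x ^ n) *\<^sub>R J)
      sums (cos x *\<^sub>R mat 1 + sin x *\<^sub>R J)"
    using cos_converges[of x] sin_converges[of x]
    by (intro sums_add sums_scaleR_left) auto
  then show ?thesis
    by (simp add: mexp_def pow sums_unique[symmetric] complex_mat_def)
qed

text \<open>By Cayley--Hamilton a traceless \<open>J\<close> with \<open>J\<^sup>2 = -1\<close> has determinant one, and then the
  determinant of \<open>x + y J\<close> is \<open>x\<^sup>2 + y\<^sup>2\<close>.\<close>

lemma det_complex_mat:
  assumes "J ** J = - mat 1" and "trace J = 0"
  shows "det (complex_mat J (cis x)) = 1"
proof -
  have j: "J $ 2 $ 2 = - J $ 1 $ 1"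
    using assms(2) by (simp add: trace_def sum_2 eq_neg_iff_add_eq_0 add.commute)
  have "(J ** J) $ 1 $ 1 = -1"
    by (simp add: assms(1) mat_def)
  then have q: "J $ 1 $ 2 * J $ 2 $ 1 = - 1 - J $ 1 $ 1 * J $ 1 $ 1"
    by (simp add: matrix_matrix_mult_def sum_2 algebra_simps)
  have c: "complex_mat J (cis x) $ i $ j = of_real (cos x) * mat 1 $ i $ j + of_real (sin x) * J $ i $ j"
    for i j
    by (simp add: complex_mat_def scaleR_conv_of_real[where 'a = complex])
  have "det (complex_mat J (cis x)) = (cos x)^2 - (sin x)^2 * (J$1$1*J$1$1 + J$1$2 * J$2$1)"
    by (simp add: det_2 c mat_def j algebra_simps power2_eq_square)
  also have "\<dots> = complex_of_real ((cos x)^2 + (sin x)^2)"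
    unfolding q by (simp del: sin_cos_squared_add2)
  finally show ?thesis
    by (simp only: sin_cos_squared_add2 of_real_1)
qed

section \<open>Products of Pauli matrices\<close>

definition herm :: "real^3 \<Rightarrow> mat2" where
  "herm a = a$1 *\<^sub>R e1 + a$2 *\<^sub>R e2 + a$3 *\<^sub>R e3"

text \<open>The factor two makes unit vectors give matrices whose squares are \<open>1\<close> and \<open>-1\<close>
  respectively.\<close>

definition pauli :: "real^3 \<Rightarrow> mat2" where
  "pauli a = 2 *\<^sub>R herm a"

definition ipauli :: "real^3 \<Rightarrow> mat2" where
  "ipauli a = 2 *\<^sub>R (a$1 *\<^sub>R e4 + a$2 *\<^sub>R e5 + a$3 *\<^sub>R e6)"

lemmas e_defs = e1_def e2_def e3_def e4_def e5_def e6_def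

lemma pauli_mult:
  "pauli a ** pauli b = (a \<bullet> b) *\<^sub>R mat 1 - ipauli (cross3 a b)"
  "ipauli a ** ipauli b = - ((a \<bullet> b) *\<^sub>R mat 1) + ipauli (cross3 a b)"
  "a \<bullet> b = 0 \<Longrightarrow> pauli a ** ipauli b = pauli (cross3 a b)"
  "a \<bullet> b = 0 \<Longrightarrow> ipauli a ** pauli b = pauli (cross3 a b)"
  by (auto simp: pauli_def ipauli_def herm_def e_defs matrix_matrix_mult_def mat_def
      vec_eq_iff forall_2 sum_2 complex_eq_iff cross3_def inner_vec_def sum_3 algebra_simps)

lemma pauli_linear:
  "pauli (r *\<^sub>R a) = r *\<^sub>R pauli a" "ipauli (r *\<^sub>R a) = r *\<^sub>R ipauli a"
  "pauli (a + b) = pauli a + pauli b" "pauli (- a) = - pauli a"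
  by (simp_all add: pauli_def ipauli_def herm_def algebra_simps)

lemma trace_pauli: "trace (r *\<^sub>R pauli a + s *\<^sub>R ipauli b) = 0"
  by (simp add: pauli_def ipauli_def herm_def e_defs trace_def sum_2)

lemma herm_in_H0: "herm a \<in> H0"
  unfolding herm_def H0_def by (intro span_add span_scale span_base) auto

lemma H0_inner_herm: "H0_inner (herm a) (herm a) = a \<bullet> a"
proof -
  let ?B = "{e1, e2, e3}"
  have r: "representation ?B (herm a) b
      = (\<Sum>i\<in>UNIV. a$i * (if b = vector [e1, e2, e3] $ i then 1 else 0))" for b
    unfolding herm_def
    by (auto simp: real_vector.representation_add[OF independent_e]
        real_vector.representation_scale[OF independent_e]
        real_vector.representation_basis[OF independent_e] span_add span_scale span_base sum_3)
  show ?thesis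
    using e_distinct by (simp add: H0_inner_def r sum_3 inner_vec_def)
qed

lemma H0_inner_nonneg: "H0_inner X X \<ge> 0"
  by (simp add: H0_inner_def sum_nonneg)

lemma sr_geodesic_eq_mexp:
  "sr_geodesic \<alpha> \<beta> t
    = mexp ((t / 2) *\<^sub>R (pauli \<alpha> + ipauli \<beta>)) ** mexp ((- t / 2) *\<^sub>R ipauli \<beta>)"
  by (simp add: sr_geodesic_def pauli_def ipauli_def herm_def scaleR_add_right add.assoc)

lemma ipauli_squared:
  assumes "norm n = 1"
  shows "ipauli n ** ipauli n = - mat 1"
proof -
  have "ipauli 0 = 0" by (simp add: ipauli_def)
  then show ?thesis
    using assms by (simp add: pauli_mult dot_square_norm)
qed

lemma pauli_ipauli_commute:
  assumes "\<alpha> \<bullet> n = 0"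
  shows "ipauli n ** pauli \<alpha> = - (pauli \<alpha> ** ipauli n)"
  using assms cross_skew[of n \<alpha>] by (simp add: pauli_mult inner_commute pauli_linear)

lemma pauli_ipauli_squared:
  assumes "norm \<alpha> = 1" "norm n = 1" "\<alpha> \<bullet> n = 0" "k\<^sup>2 = 1 + h\<^sup>2"
  shows "(h *\<^sub>R pauli \<alpha> + k *\<^sub>R ipauli n) ** (h *\<^sub>R pauli \<alpha> + k *\<^sub>R ipauli n) = - mat 1"
proof -
  have "pauli \<alpha> ** pauli \<alpha> = mat 1"
    using assms(1) by (simp add: pauli_mult dot_square_norm ipauli_def)
  moreover note pauli_ipauli_commute[OF assms(3)]
  moreover have "(k * k) *\<^sub>R (mat 1 :: mat2) = (1 + h * h) *\<^sub>R mat 1"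
    using assms(4) by (simp add: power2_eq_square)
  ultimately show ?thesis
    by (simp add: matrix_expand ipauli_squared[OF assms(2)] mult.commute scaleR_left_distrib
        scaleR_right_diff_distrib)
qed

lemma complex_mat_has_vector_derivative:
  assumes "J ** J = - mat 1"
  shows "((\<lambda>t. complex_mat J (cis (r * t))) has_vector_derivative
      r *\<^sub>R (complex_mat J (cis (r * t)) ** J)) (at t within S)"
proof -
  have "((\<lambda>t. cos (r * t) *\<^sub>R mat 1 + sin (r * t) *\<^sub>R J) has_vector_derivative
      (- sin (r * t) * r) *\<^sub>R mat 1 + (cos (r * t) * r) *\<^sub>R J) (at t within S)"
    by (auto intro!: derivative_eq_intros)
  then show ?thesis
    by (simp add: complex_mat_def matrix_expand assms scaleR_right_diff_distrib algebra_simps)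
qed

lemma complex_mat_pauli_commute:
  assumes "\<alpha> \<bullet> n = 0"
  shows "complex_mat (ipauli n) z ** pauli \<alpha> = pauli \<alpha> ** complex_mat (ipauli n) (cnj z)"
  by (simp add: complex_mat_def matrix_expand pauli_ipauli_commute[OF assms])

text \<open>For \<open>\<alpha>\<close> orthogonal to the unit vector \<open>n\<close> this turns \<open>\<alpha>\<close> about \<open>n\<close> by the angle \<open>- \<phi>\<close>. The
  orientation is chosen so that the turn becomes right multiplication by \<open>exp(\<phi> N)\<close> in
  \<open>pauli_rotate_about\<close>.\<close>

definition rotate_about :: "real^3 \<Rightarrow> real \<Rightarrow> real^3 \<Rightarrow> real^3" where
  "rotate_about n \<phi> \<alpha> = cos \<phi> *\<^sub>R \<alpha> + sin \<phi> *\<^sub>R cross3 \<alpha> n"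

lemma rotate_about_orthonormal:
  assumes "norm \<alpha> = 1" "norm n = 1" "\<alpha> \<bullet> n = 0"
  shows "norm (rotate_about n \<phi> \<alpha>) = 1" "rotate_about n \<phi> \<alpha> \<bullet> n = 0"
proof -
  have "(norm (cross3 \<alpha> n))\<^sup>2 = 1"
    using norm_cross_dot[of \<alpha> n] assms by simp
  then have "cross3 \<alpha> n \<bullet> cross3 \<alpha> n = 1" by (simp add: dot_square_norm)
  moreover have "\<alpha> \<bullet> \<alpha> = 1" using assms by (simp add: dot_square_norm)
  ultimately have "rotate_about n \<phi> \<alpha> \<bullet> rotate_about n \<phi> \<alpha> = 1"
    by (simp add: rotate_about_def inner_add_left inner_add_right dot_cross_self inner_commute
        flip: power2_eq_square)
  then show "norm (rotate_about n \<phi> \<alpha>) = 1" by (simp add: norm_eq_1)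
  show "rotate_about n \<phi> \<alpha> \<bullet> n = 0"
    using assms by (simp add: rotate_about_def inner_add_left dot_cross_self)
qed

lemma pauli_rotate_about:
  assumes "\<alpha> \<bullet> n = 0"
  shows "pauli (rotate_about n \<phi> \<alpha>) = pauli \<alpha> ** complex_mat (ipauli n) (cis \<phi>)"
  using assms by (simp add: rotate_about_def complex_mat_def matrix_expand pauli_mult pauli_linear)

section \<open>Geodesics with orthogonal parameters\<close>

text \<open>A vector \<open>\<beta>\<close> of norm above one is \<open>(k / h) n\<close> for unique \<open>h, k > 0\<close> with \<open>k\<^sup>2 = 1 + h\<^sup>2\<close> and a
  unique unit vector \<open>n\<close>. In these parameters the total exponent is \<open>t / (2 h)\<close> times a square
  root of minus one.\<close>

locale orthogonal_geodesic =
  fixes \<alpha> n :: "real^3" and h k :: real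
  assumes unit: "norm \<alpha> = 1" "norm n = 1" and orth: "\<alpha> \<bullet> n = 0"
    and h: "0 < h" and k: "k\<^sup>2 = 1 + h\<^sup>2"
begin

abbreviation "J \<equiv> h *\<^sub>R pauli \<alpha> + k *\<^sub>R ipauli n"
abbreviation "geo \<equiv> sr_geodesic \<alpha> ((k / h) *\<^sub>R n)"

lemma J_squared: "J ** J = - mat 1"
  using pauli_ipauli_squared unit orth k by blast

lemma geo_factors:
  "geo t = complex_mat J (cis (1 / (2 * h) * t)) ** complex_mat (ipauli n) (cis (- k / (2 * h) * t))"
proof -
  have "(t / 2) *\<^sub>R (pauli \<alpha> + ipauli ((k / h) *\<^sub>R n)) = (1 / (2 * h) * t) *\<^sub>R J"
    using h by (simp add: pauli_linear scaleR_add_right)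
  moreover have "(- t / 2) *\<^sub>R ipauli ((k / h) *\<^sub>R n) = (- k / (2 * h) * t) *\<^sub>R ipauli n"
    by (simp add: pauli_linear)
  ultimately show ?thesis
    unfolding sr_geodesic_eq_mexp
    by (simp only: mexp_square_root_of_minus_one[OF J_squared]
        mexp_square_root_of_minus_one[OF ipauli_squared[OF unit(2)]])
qed

text \<open>The right-hand side is \<open>p + P q\<close>. The complex factor \<open>p\<close> does not involve \<open>\<alpha>\<close>, and
  turning \<open>\<alpha>\<close> about \<open>n\<close> only changes the argument of \<open>q\<close>.\<close>

lemma geo_closed_form:
  "geo (2 * h * \<tau>) = complex_mat (ipauli n) (Complex (cos \<tau>) (k * sin \<tau>) * cis (- k * \<tau>))
     + pauli \<alpha> ** complex_mat (ipauli n) ((h * sin \<tau>) *\<^sub>R cis (- k * \<tau>))"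
proof -
  have "complex_mat J (cis \<tau>)
      = complex_mat (ipauli n) (Complex (cos \<tau>) (k * sin \<tau>)) + (h * sin \<tau>) *\<^sub>R pauli \<alpha>"
    by (simp add: complex_mat_def scaleR_add_right mult.commute)
  moreover have "complex_mat (ipauli n) (r *\<^sub>R z) = r *\<^sub>R complex_mat (ipauli n) z" for r z
    by (simp add: complex_mat_def scaleR_add_right)
  ultimately show ?thesis
    using h by (simp add: geo_factors matrix_expand complex_mat_mult[OF ipauli_squared[OF unit(2)]])
qed

lemma geo_in_SL2C: "geo t \<in> SL2C"
proof -
  have "trace J = 0" "trace (ipauli n) = 0"
    using trace_pauli[of h \<alpha> k n] trace_pauli[of 0 \<alpha> 1 n] by simp_all
  then show ?thesis
    by (simp add: SL2C_def geo_factors det_mul det_complex_mat J_squared ipauli_squared unit)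
qed

text \<open>Let \<open>X\<close> and \<open>Y\<close> be the two exponential factors, \<open>E\<close> the horizontal part of the first
  exponent and \<open>Y'\<close> the inverse of \<open>Y\<close>. The velocity of \<open>X Y\<close> is \<open>X E Y = X Y (Y' E Y)\<close>, and
  conjugating \<open>E\<close> by \<open>Y\<close> turns \<open>\<alpha>\<close> about \<open>n\<close> at constant speed.\<close>

definition geo_control :: "real \<Rightarrow> mat2" where
  "geo_control t = herm (rotate_about n (- (k / h) * t) \<alpha>)"

lemma geo_control_in_H0: "geo_control t \<in> H0"
  by (simp add: geo_control_def herm_in_H0)

lemma H0_inner_geo_control: "H0_inner (geo_control t) (geo_control t) = 1"
  using rotate_about_orthonormal(1)[OF unit orth]
  by (simp add: geo_control_def H0_inner_herm norm_eq_1)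

lemma geo_has_vector_derivative:
  "(geo has_vector_derivative (geo t ** geo_control t)) (at t within S)"
proof -
  let ?N = "ipauli n"
  let ?X = "complex_mat J (cis (1 / (2 * h) * t))"
  let ?Y = "complex_mat ?N (cis (- k / (2 * h) * t))"
  have N: "?N ** ?N = - mat 1" by (rule ipauli_squared[OF unit(2)])
  have NY: "complex_mat ?N z ** ?N = ?N ** complex_mat ?N z" for z
    by (simp add: complex_mat_def matrix_expand)
  have "(geo has_vector_derivative
      ?X ** ((- k / (2 * h)) *\<^sub>R (?Y ** ?N)) + ((1 / (2 * h)) *\<^sub>R (?X ** J)) ** ?Y) (at t within S)"
    unfolding geo_factors[abs_def]
    by (rule bounded_bilinear.has_vector_derivative[OF bounded_bilinear_matrix_mult];
        rule complex_mat_has_vector_derivative; rule J_squared N)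
  also have "?X ** ((- k / (2 * h)) *\<^sub>R (?Y ** ?N)) + ((1 / (2 * h)) *\<^sub>R (?X ** J)) ** ?Y
      = (1 / 2) *\<^sub>R (?X ** pauli \<alpha> ** ?Y)"
    using h by (simp add: NY matrix_expand scaleR_add_right flip: matrix_mul_assoc)
  also have "\<dots> = geo t ** geo_control t"
  proof -
    let ?Z = "complex_mat ?N (cis (- (k / h) * t))"
    have PY: "pauli \<alpha> ** ?Y = ?Y ** (pauli \<alpha> ** ?Z)"
      using h
      by (simp add: complex_mat_pauli_commute[OF orth] complex_mat_mult[OF N] cis_cnj cis_mult
          matrix_mul_assoc) (simp add: complex_mat_mult[OF N] cis_mult flip: matrix_mul_assoc)
    have control: "geo_control t = (1 / 2) *\<^sub>R (pauli \<alpha> ** ?Z)"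
      unfolding pauli_rotate_about[OF orth, symmetric] by (simp add: geo_control_def pauli_def)
    have "?X ** pauli \<alpha> ** ?Y = ?X ** ?Y ** (pauli \<alpha> ** ?Z)"
      unfolding matrix_mul_assoc[symmetric] PY ..
    then show ?thesis
      by (simp only: geo_factors control matrix_mult_scaleR)
  qed
  finally show ?thesis .
qed

end

section \<open>Concatenation and length of horizontal paths\<close>

lemma partition_le:
  fixes p :: "nat \<Rightarrow> real"
  assumes "\<forall>i<n. p i < p (Suc i)" "i \<le> j" "j \<le> n"
  shows "p i \<le> p j"
  using assms(2,3)
proof (induction j rule: dec_induct)
  case (step m)
  then show ?case using assms(1) by (meson Suc_le_eq less_imp_le order.strict_trans2 order_trans)
qed simp

lemma shifted_vector_derivative:
  assumes "(f has_vector_derivative D) (at (t + r) within (\<lambda>t. t + r) ` S)"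
  shows "((\<lambda>t. f (t + r)) has_vector_derivative D) (at t within S)"
proof -
  have "((\<lambda>t. t + r) has_vector_derivative 1) (at t within S)"
    by (auto intro!: derivative_eq_intros)
  from vector_diff_chain_within[OF this assms] show ?thesis
    by (simp add: o_def)
qed

context
  fixes \<gamma>\<^sub>1 \<gamma>\<^sub>2 :: "real \<Rightarrow> mat2" and b c :: real and \<gamma> :: "real \<Rightarrow> mat2"
  assumes meet: "\<gamma>\<^sub>1 b = \<gamma>\<^sub>2 c"
  defines "\<gamma> \<equiv> \<lambda>t. if t \<le> b then \<gamma>\<^sub>1 t else \<gamma>\<^sub>2 (t + (c - b))"
begin

lemma piecewise_C1_path_append:
  assumes "piecewise_C1_path \<gamma>\<^sub>1 a b" "piecewise_C1_path \<gamma>\<^sub>2 c d"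
  shows "piecewise_C1_path \<gamma> a (b + (d - c))"
proof -
  obtain n p D where p: "p 0 = a" "p n = b" "\<forall>i<n. p i < p (Suc i)"
    and D: "\<And>i. i < n \<Longrightarrow> continuous_on {p i..p (Suc i)} (D i)"
      "\<And>i t. i < n \<Longrightarrow> t \<in> {p i..p (Suc i)} \<Longrightarrow>
        (\<gamma>\<^sub>1 has_vector_derivative D i t) (at t within {p i..p (Suc i)})"
    using assms(1) unfolding piecewise_C1_path_def by metis
  obtain m q E where q: "q 0 = c" "q m = d" "\<forall>i<m. q i < q (Suc i)"
    and E: "\<And>i. i < m \<Longrightarrow> continuous_on {q i..q (Suc i)} (E i)"
      "\<And>i t. i < m \<Longrightarrow> t \<in> {q i..q (Suc i)} \<Longrightarrow>
        (\<gamma>\<^sub>2 has_vector_derivative E i t) (at t within {q i..q (Suc i)})"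
    using assms(2) unfolding piecewise_C1_path_def by metis
  define r where "r i = (if i \<le> n then p i else q (i - n) + (b - c))" for i
  have r_right: "r i = q (i - n) + (b - c)" if "n \<le> i" for i
    using that p q by (cases "i = n") (auto simp: r_def)
  have "\<exists>F. continuous_on {r i..r (Suc i)} F \<and>
      (\<forall>t\<in>{r i..r (Suc i)}. (\<gamma> has_vector_derivative F t) (at t within {r i..r (Suc i)}))"
    if i: "i < n + m" for i
  proof (cases "i < n")
    case True
    have "p (Suc i) \<le> b" using partition_le[OF p(3), of "Suc i" n] True p(2) by simp
    then have "(\<gamma> has_vector_derivative D i t) (at t within {p i..p (Suc i)})"
      if "t \<in> {p i..p (Suc i)}" for t
      using that D(2)[OF True that]
      by (intro has_vector_derivative_transform[OF that _ D(2)[OF True that]]) (auto simp: \<gamma>_def)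
    then show ?thesis using D(1)[OF True] True by (intro exI[of _ "D i"]) (auto simp: r_def)
  next
    case False
    define j where "j = i - n"
    have j: "j < m" using False i by (simp add: j_def)
    have r: "r i = q j + (b - c)" "r (Suc i) = q (Suc j) + (b - c)"
      using False by (simp_all add: r_right j_def Suc_diff_le)
    have im: "(\<lambda>t. t + (c - b)) ` {r i..r (Suc i)} = {q j..q (Suc j)}"
      unfolding r image_add_atLeastAtMost' by simp
    have "b \<le> r i" using partition_le[OF q(3), of 0 j] j q(1) by (simp add: r)
    show ?thesis
    proof (intro exI[of _ "\<lambda>t. E j (t + (c - b))"] conjI ballI)
      show "continuous_on {r i..r (Suc i)} (\<lambda>t. E j (t + (c - b)))"
        by (rule continuous_on_compose2[OF E(1)[OF j]]) (use im in \<open>auto intro!: continuous_intros\<close>)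
      fix t assume t: "t \<in> {r i..r (Suc i)}"
      have "((\<lambda>t. \<gamma>\<^sub>2 (t + (c - b))) has_vector_derivative E j (t + (c - b)))
          (at t within {r i..r (Suc i)})"
        by (rule shifted_vector_derivative) (use im t E(2)[OF j] in auto)
      moreover have "\<gamma> x = \<gamma>\<^sub>2 (x + (c - b))" if "x \<in> {r i..r (Suc i)}" for x
        using that \<open>b \<le> r i\<close> meet by (cases "x = b") (auto simp: \<gamma>_def)
      ultimately show
        "(\<gamma> has_vector_derivative E j (t + (c - b))) (at t within {r i..r (Suc i)})"
        by (rule has_vector_derivative_transform[OF t, rotated])
    qed
  qed
  moreover have "r i < r (Suc i)" if "i < n + m" for i
  proof (cases "i < n")
    case True
    then show ?thesis using p(3) by (simp add: r_def)
  next
    case False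
    then show ?thesis using q(3) that by (simp add: r_right Suc_diff_le)
  qed
  moreover have "r 0 = a" "r (n + m) = b + (d - c)"
    using p q by (simp_all add: r_def[of 0] r_right)
  ultimately show ?thesis
    unfolding piecewise_C1_path_def by (intro exI[of _ "n + m"] exI[of _ r]) auto
qed

lemma horizontal_path_append:
  assumes "horizontal_path \<gamma>\<^sub>1 u\<^sub>1 a b" "horizontal_path \<gamma>\<^sub>2 u\<^sub>2 c d"
  shows "horizontal_path \<gamma> (\<lambda>t. if t \<le> b then u\<^sub>1 t else u\<^sub>2 (t + (c - b))) a (b + (d - c))"
proof -
  let ?u = "\<lambda>t. if t \<le> b then u\<^sub>1 t else u\<^sub>2 (t + (c - b))"
  obtain S\<^sub>1 where S1: "finite S\<^sub>1" "\<And>t. t \<in> {a..b} - S\<^sub>1 \<Longrightarrow>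
      u\<^sub>1 t \<in> H0 \<and> (\<gamma>\<^sub>1 has_vector_derivative (\<gamma>\<^sub>1 t ** u\<^sub>1 t)) (at t)"
    using assms(1) unfolding horizontal_path_def by blast
  obtain S\<^sub>2 where S2: "finite S\<^sub>2" "\<And>t. t \<in> {c..d} - S\<^sub>2 \<Longrightarrow>
      u\<^sub>2 t \<in> H0 \<and> (\<gamma>\<^sub>2 has_vector_derivative (\<gamma>\<^sub>2 t ** u\<^sub>2 t)) (at t)"
    using assms(2) unfolding horizontal_path_def by blast
  define S where "S = S\<^sub>1 \<union> (\<lambda>t. t + (b - c)) ` S\<^sub>2 \<union> {b}"
  have "?u t \<in> H0 \<and> (\<gamma> has_vector_derivative (\<gamma> t ** ?u t)) (at t)"
    if t: "t \<in> {a..b + (d - c)} - S" for t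
  proof (cases "t < b")
    case True
    then have "t \<in> {a..b} - S\<^sub>1" using t by (auto simp: S_def)
    from S1(2)[OF this] have "(\<gamma> has_vector_derivative (\<gamma>\<^sub>1 t ** u\<^sub>1 t)) (at t)" "u\<^sub>1 t \<in> H0"
      using True
      by (auto intro: has_vector_derivative_transform_within_open[of _ _ _ "{..<b}"] simp: \<gamma>_def)
    then show ?thesis using True by (simp add: \<gamma>_def)
  next
    case False
    then have "b < t" using t by (auto simp: S_def)
    have "t + (c - b) \<notin> S\<^sub>2"
    proof
      assume "t + (c - b) \<in> S\<^sub>2"
      then have "t + (c - b) + (b - c) \<in> S" unfolding S_def by blast
      then show False using t by simp
    qed
    then have "t + (c - b) \<in> {c..d} - S\<^sub>2" using t \<open>b < t\<close> by auto
    from S2(2)[OF this]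
    have u: "u\<^sub>2 (t + (c - b)) \<in> H0" and der: "((\<lambda>t. \<gamma>\<^sub>2 (t + (c - b))) has_vector_derivative
        \<gamma>\<^sub>2 (t + (c - b)) ** u\<^sub>2 (t + (c - b))) (at t)"
      by (auto intro: shifted_vector_derivative has_vector_derivative_at_within)
    have "(\<gamma> has_vector_derivative \<gamma>\<^sub>2 (t + (c - b)) ** u\<^sub>2 (t + (c - b))) (at t)"
      using \<open>b < t\<close>
      by (intro has_vector_derivative_transform_within_open[OF der, of "{b<..}"]) (auto simp: \<gamma>_def)
    with u show ?thesis using \<open>b < t\<close> by (simp add: \<gamma>_def)
  qed
  moreover have "finite S" using S1(1) S2(1) by (simp add: S_def)
  moreover have "\<gamma> t \<in> SL2C" if "t \<in> {a..b + (d - c)}" for t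
    using assms that by (auto simp: horizontal_path_def \<gamma>_def)
  moreover have "piecewise_C1_path \<gamma> a (b + (d - c))"
    using assms piecewise_C1_path_append by (auto simp: horizontal_path_def)
  moreover have "a \<le> b + (d - c)" using assms by (auto simp: horizontal_path_def)
  ultimately show ?thesis unfolding horizontal_path_def by blast
qed

end

lemma control_length_nonneg: "0 \<le> control_length u a b"
proof -
  have "0 \<le> integral {a..b} (\<lambda>t. sqrt (H0_inner (u t) (u t)))"
    if "(\<lambda>t. sqrt (H0_inner (u t) (u t))) integrable_on {a..b}"
    using that by (intro integral_nonneg) (simp_all add: H0_inner_nonneg)
  then show ?thesis
    unfolding control_length_def using not_integrable_integral by (metis order_refl)
qed

lemma sr_dist_le_control_length:
  assumes "horizontal_path \<gamma> u 0 a"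
  shows "sr_dist (\<gamma> 0) (\<gamma> a) \<le> control_length u 0 a"
  unfolding sr_dist_def
  by (rule cInf_lower) (use assms control_length_nonneg in \<open>auto simp: bdd_below_def\<close>)

lemma control_length_unit_speed:
  assumes "a \<le> b" "finite S" "\<And>t. t \<in> {a..b} - S \<Longrightarrow> H0_inner (u t) (u t) = 1"
  shows "control_length u a b = b - a"
proof -
  have "control_length u a b = integral {a..b} (\<lambda>_. 1)"
    unfolding control_length_def
    by (rule integral_spike[OF negligible_finite[OF assms(2)]]) (simp add: assms(3))
  then show ?thesis using assms(1) by simp
qed

context orthogonal_geodesic
begin

lemma horizontal_path_geo:
  assumes "a < b"
  shows "horizontal_path geo geo_control a b"
proof -
  have "continuous_on {a..b} geo"
    using geo_has_vector_derivative
    by (meson continuous_on_eq_continuous_within has_vector_derivative_continuous)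
  moreover have "continuous_on {a..b} geo_control"
    unfolding geo_control_def[abs_def] herm_def rotate_about_def
    by (intro continuous_intros)
  ultimately have "continuous_on {a..b} (\<lambda>t. geo t ** geo_control t)"
    by (rule bounded_bilinear.continuous_on[OF bounded_bilinear_matrix_mult])
  then have "piecewise_C1_path geo a b"
    unfolding piecewise_C1_path_def using assms geo_has_vector_derivative
    by (intro exI[of _ "1::nat"] exI[of _ "\<lambda>i. if i = 0 then a else b"]) auto
  then show ?thesis
    using assms geo_has_vector_derivative geo_in_SL2C geo_control_in_H0
    unfolding horizontal_path_def by auto
qed

text \<open>A group element can be cancelled on the left, so outside a finite set every control of the
  geodesic agrees with the one that turns at constant speed, which has norm one.\<close>

lemma control_length_geo:
  assumes "horizontal_path geo u a b"
  shows "control_length u a b = b - a"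
proof -
  obtain S where S: "finite S"
    "\<And>t. t \<in> {a..b} - S \<Longrightarrow> (geo has_vector_derivative (geo t ** u t)) (at t)"
    using assms unfolding horizontal_path_def by blast
  have "H0_inner (u t) (u t) = 1" if t: "t \<in> {a..b} - S" for t
  proof -
    have "geo t ** u t = geo t ** geo_control t"
      using S(2)[OF t] geo_has_vector_derivative by (rule vector_derivative_unique_at)
    moreover have "invertible (geo t)"
      using geo_in_SL2C[of t] by (simp add: SL2C_def invertible_det_nz)
    ultimately have "u t = geo_control t"
      by (metis invertible_def matrix_mul_assoc matrix_mul_lid)
    then show ?thesis by (simp add: H0_inner_geo_control)
  qed
  then show ?thesis
    using assms S(1) by (intro control_length_unit_speed) (auto simp: horizontal_path_def)
qed

end

section \<open>A shorter geodesic to the same point\<close>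

lemma arctan_ge_half:
  fixes t :: real
  assumes "0 \<le> t" "t \<le> 1"
  shows "t / 2 \<le> arctan t"
proof -
  have "arctan 0 - 0 / 2 \<le> arctan t - t / 2"
  proof (rule DERIV_nonneg_imp_nondecreasing[OF assms(1)])
    fix x :: real assume x: "0 \<le> x" "x \<le> t"
    have "x\<^sup>2 \<le> 1" using x assms by (simp add: power_le_one)
    then have "inverse (1 + x\<^sup>2) - 1 / 2 \<ge> 0" by (simp add: field_simps add_pos_nonneg)
    moreover have "((\<lambda>x. arctan x - x / 2) has_real_derivative inverse (1 + x\<^sup>2) - 1 / 2) (at x)"
      by (auto intro!: derivative_eq_intros)
    ultimately show "\<exists>y. ((\<lambda>x. arctan x - x / 2) has_real_derivative y) (at x) \<and> 0 \<le> y"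
      by blast
  qed
  then show ?thesis by simp
qed

text \<open>With \<open>t = tan \<theta>\<close> and \<open>\<delta>\<close> for the defect, \<open>p\<close> at \<open>\<tau> = \<pi> + \<theta>\<close> is a negative multiple of
  \<open>exp(- \<i> (k \<pi> + \<delta>))\<close>. At \<open>\<tau> = \<pi> - \<theta>\<close> it is one of \<open>exp(- \<i> (k \<pi> - \<delta>))\<close>.\<close>

definition arctan_defect :: "real \<Rightarrow> real \<Rightarrow> real" where
  "arctan_defect k t = k * arctan t - arctan (k * t)"

text \<open>The derivative in \<open>t\<close> is \<open>k / (1 + t\<^sup>2) - k / (1 + k\<^sup>2 t\<^sup>2)\<close>, which lies between \<open>0\<close> and
  \<open>k\<^sup>3 t\<^sup>2\<close>. What matters later is that the defect is of third order in \<open>t\<close>.\<close>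

lemma arctan_defect_bounds:
  assumes "1 \<le> k" "0 \<le> t"
  shows "0 \<le> arctan_defect k t" and "arctan_defect k t \<le> k ^ 3 * t ^ 3 / 3"
proof -
  let ?D = "\<lambda>x::real. k * inverse (1 + x\<^sup>2) - k * inverse (1 + (k * x)\<^sup>2)"
  have D: "(arctan_defect k has_real_derivative ?D x) (at x)" for x
    unfolding arctan_defect_def[abs_def] by (auto intro!: derivative_eq_intros)
  have pos: "1 + x\<^sup>2 > 0" "1 + (k * x)\<^sup>2 > 0" for x :: real
    by (auto intro: add_pos_nonneg)
  have ge: "0 \<le> ?D x" for x
  proof -
    have "x\<^sup>2 \<le> (k * x)\<^sup>2"
      using assms(1) by (simp add: power_mult_distrib mult_le_cancel_right1 one_le_power)
    then show ?thesis using assms(1) pos[of x] by (auto intro!: mult_left_mono le_imp_inverse_le)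
  qed
  have le: "?D x \<le> k ^ 3 * x\<^sup>2" for x
  proof -
    have a: "inverse (1 + x\<^sup>2) \<le> 1" using pos[of x] by (simp add: field_simps)
    have b: "1 - y\<^sup>2 \<le> inverse (1 + y\<^sup>2)" for y :: real
    proof -
      have "(1 - y\<^sup>2) * (1 + y\<^sup>2) \<le> 1"
        by (simp add: algebra_simps)
      moreover have "1 + y\<^sup>2 > 0" by (intro add_pos_nonneg) auto
      ultimately show ?thesis by (simp add: field_simps)
    qed
    have "inverse (1 + x\<^sup>2) - inverse (1 + (k * x)\<^sup>2) \<le> (k * x)\<^sup>2"
      using a b[of "k * x"] by linarith
    then have "k * (inverse (1 + x\<^sup>2) - inverse (1 + (k * x)\<^sup>2)) \<le> k * (k * x)\<^sup>2"
      using assms(1) by (intro mult_left_mono) auto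
    then show ?thesis by (simp add: algebra_simps power2_eq_square power3_eq_cube)
  qed
  have "arctan_defect k 0 \<le> arctan_defect k t"
    using D ge by (intro DERIV_nonneg_imp_nondecreasing[OF assms(2)]) blast
  then show "0 \<le> arctan_defect k t" by (simp add: arctan_defect_def)
  have "k ^ 3 * 0 ^ 3 / 3 - arctan_defect k 0 \<le> k ^ 3 * t ^ 3 / 3 - arctan_defect k t"
  proof (rule DERIV_nonneg_imp_nondecreasing[OF assms(2)])
    fix x
    have "((\<lambda>x. k ^ 3 * x ^ 3 / 3 - arctan_defect k x) has_real_derivative k ^ 3 * x\<^sup>2 - ?D x) (at x)"
      by (auto intro!: derivative_eq_intros D)
    with le[of x] show "\<exists>y. ((\<lambda>x. k ^ 3 * x ^ 3 / 3 - arctan_defect k x) has_real_derivative y) (at x) \<and> 0 \<le> y"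
      by (intro exI[of _ "k ^ 3 * x\<^sup>2 - ?D x"]) simp
  qed
  then show "arctan_defect k t \<le> k ^ 3 * t ^ 3 / 3"
    by (simp add: arctan_defect_def)
qed

text \<open>Moving \<open>h\<close> from \<open>h\<^sub>0\<close> up to \<open>(1 + t / 8) h\<^sub>0\<close> increases \<open>\<pi> sqrt (1 + h\<^sup>2)\<close> by an amount linear in
  \<open>t\<close>, which exceeds the sum of the two cubic defects when \<open>t\<close> is small. So a solution of the phase equation lies
  in between. Its length \<open>2 h (\<pi> - arctan t')\<close> is below \<open>2 \<pi> (1 + t / 8) h\<^sub>0\<close>, and
  \<open>\<pi> t / 8 \<le> t / 2 \<le> arctan t\<close>. The constant \<open>M\<close> bounds \<open>sqrt (1 + h\<^sup>2)\<close> for \<open>h \<le> 2 h\<^sub>0\<close>.\<close>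

lemma compensating_parameter:
  fixes h\<^sub>0 t :: real
  defines "M \<equiv> sqrt (1 + 4 * h\<^sub>0\<^sup>2)"
  assumes h: "0 < h\<^sub>0" and t: "0 < t" "t \<le> 1" "t \<le> h\<^sub>0 / (2 * M\<^sup>2)"
  obtains h t' where "0 < h" "0 < t'"
    "h * sin (arctan t') = h\<^sub>0 * sin (arctan t)"
    "sqrt (1 + h\<^sup>2) * pi - arctan_defect (sqrt (1 + h\<^sup>2)) t'
      = sqrt (1 + h\<^sub>0\<^sup>2) * pi + arctan_defect (sqrt (1 + h\<^sub>0\<^sup>2)) t"
    "h * (pi - arctan t') < h\<^sub>0 * (pi + arctan t)"
proof -
  define s where "s = h\<^sub>0 * sin (arctan t)"
  define h\<^sub>1 where "h\<^sub>1 = (1 + t / 8) * h\<^sub>0"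
  define K where "K h = sqrt (1 + h\<^sup>2)" for h :: real
  \<comment> \<open>\<open>w h\<close> is the tangent of the acute angle whose sine is \<open>s / h\<close>.\<close>
  define w where "w h = s / sqrt (h\<^sup>2 - s\<^sup>2)" for h
  define F where "F h = K h * pi - arctan_defect (K h) (w h)" for h
  have s: "0 < s" "s < h\<^sub>0" "s\<^sup>2 < h\<^sub>0\<^sup>2"
  proof -
    have "t < sqrt (1 + t\<^sup>2)" using t by (intro real_less_rsqrt) simp
    then show *: "0 < s" "s < h\<^sub>0"
      using h t by (auto simp: s_def sin_arctan field_simps add_pos_nonneg)
    then show "s\<^sup>2 < h\<^sub>0\<^sup>2" by (intro power_strict_mono) auto
  qed
  have sq: "s\<^sup>2 < h\<^sup>2" if "h\<^sub>0 \<le> h" for h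
    using s h that by (intro power_strict_mono) auto
  have h01: "h\<^sub>0 \<le> h\<^sub>1" "h\<^sub>1 \<le> 2 * h\<^sub>0"
    using h t by (auto simp: h\<^sub>1_def)
  have K1: "1 \<le> K h" for h by (simp add: K_def)
  have w_pos: "0 < w h" if "h\<^sub>0 \<le> h" for h
    using s(1) sq[OF that] by (simp add: w_def)
  have w_sin: "h * sin (arctan (w h)) = s" if "h\<^sub>0 \<le> h" for h
  proof -
    have "1 + (w h)\<^sup>2 = h\<^sup>2 / (h\<^sup>2 - s\<^sup>2)"
      using sq[OF that] by (simp add: w_def power_divide field_simps)
    then show ?thesis
      using sq[OF that] that h by (simp add: sin_arctan real_sqrt_divide) (simp add: w_def)
  qed
  have w_h0: "w h\<^sub>0 = t"
  proof -
    have "s\<^sup>2 = h\<^sub>0\<^sup>2 * t\<^sup>2 / (1 + t\<^sup>2)"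
      by (simp add: s_def sin_arctan power_mult_distrib power_divide)
    moreover have pos: "1 + t\<^sup>2 > 0" by (intro add_pos_nonneg) auto
    ultimately have "h\<^sub>0\<^sup>2 - s\<^sup>2 = h\<^sub>0\<^sup>2 / (1 + t\<^sup>2)"
      by (simp add: field_simps)
    then show ?thesis
      using h pos by (simp add: w_def real_sqrt_divide s_def sin_arctan)
  qed
  have w_anti: "w h\<^sub>1 \<le> t"
  proof -
    have "h\<^sub>0\<^sup>2 \<le> h\<^sub>1\<^sup>2" using h01 h by (intro power_mono) auto
    then have "w h\<^sub>1 \<le> w h\<^sub>0"
      unfolding w_def using s by (intro divide_left_mono) auto
    then show ?thesis by (simp add: w_h0)
  qed
  have KM: "K h\<^sub>0 \<le> M" "K h\<^sub>1 \<le> M" "1 \<le> M"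
  proof -
    have "h\<^sub>1\<^sup>2 \<le> (2 * h\<^sub>0)\<^sup>2" using h01 h by (intro power_mono) auto
    then show "K h\<^sub>1 \<le> M" by (simp add: K_def M_def power_mult_distrib)
  qed (auto simp: K_def M_def)
  have small: "arctan_defect (K h) (w h) \<le> M ^ 3 * t ^ 3 / 3" if "h \<in> {h\<^sub>0, h\<^sub>1}" for h
  proof -
    have w: "0 \<le> w h" "w h \<le> t" "K h \<le> M" and "h\<^sub>0 \<le> h"
      using that w_pos[of h] w_anti w_h0 KM h01 by auto
    have "(K h * w h) ^ 3 \<le> (M * t) ^ 3"
      using w K1[of h] KM by (intro power_mono mult_mono) auto
    then show ?thesis
      using arctan_defect_bounds(2)[OF K1[of h] w(1)] by (simp add: power_mult_distrib)
  qed
  have gain: "h\<^sub>0\<^sup>2 * t / (8 * M) \<le> K h\<^sub>1 - K h\<^sub>0"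
  proof -
    have "(K h\<^sub>1 - K h\<^sub>0) * (K h\<^sub>1 + K h\<^sub>0) = h\<^sub>1\<^sup>2 - h\<^sub>0\<^sup>2"
      by (simp add: K_def algebra_simps flip: power2_eq_square)
    also have "\<dots> = h\<^sub>0\<^sup>2 * (t / 4 + (t / 8)\<^sup>2)"
      by (simp add: h\<^sub>1_def power2_eq_square algebra_simps)
    also have "\<dots> \<ge> h\<^sub>0\<^sup>2 * (t / 4)"
      by (intro mult_left_mono) auto
    finally have "h\<^sub>0\<^sup>2 * (t / 4) \<le> (K h\<^sub>1 - K h\<^sub>0) * (K h\<^sub>1 + K h\<^sub>0)" .
    also have "\<dots> \<le> (K h\<^sub>1 - K h\<^sub>0) * (2 * M)"
      using KM h01 h by (intro mult_left_mono) (auto simp: K_def)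
    finally show ?thesis using KM(3) by (simp add: field_simps)
  qed
  have "2 * (M ^ 3 * t ^ 3 / 3) \<le> pi * (h\<^sub>0\<^sup>2 * t / (8 * M))"
  proof -
    have "t\<^sup>2 \<le> (h\<^sub>0 / (2 * M\<^sup>2))\<^sup>2" using t by (intro power_mono) auto
    then have "M ^ 4 * t\<^sup>2 \<le> h\<^sub>0\<^sup>2 / 4"
      using KM(3) by (simp add: power_divide power_mult_distrib field_simps)
    then have "(M ^ 4 * t\<^sup>2) * (2 / 3 * t / M) \<le> h\<^sub>0\<^sup>2 / 4 * (2 / 3 * t / M)"
      using KM(3) t by (intro mult_right_mono) auto
    also have "\<dots> \<le> 3 * (h\<^sub>0\<^sup>2 * t / (8 * M))"
      using KM(3) t by (simp add: field_simps)
    also have "\<dots> \<le> pi * (h\<^sub>0\<^sup>2 * t / (8 * M))"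
      using KM(3) t pi_gt3 by (intro mult_right_mono) auto
    finally show ?thesis
      using KM(3) by (simp add: field_simps power2_eq_square power3_eq_cube power4_eq_xxxx)
  qed
  then have "2 * (M ^ 3 * t ^ 3 / 3) \<le> pi * (K h\<^sub>1 - K h\<^sub>0)"
    using gain by (meson mult_left_mono order_trans pi_ge_zero)
  then have upper: "K h\<^sub>0 * pi + arctan_defect (K h\<^sub>0) t \<le> F h\<^sub>1"
    using small[of h\<^sub>0] small[of h\<^sub>1] w_h0 by (simp add: F_def algebra_simps)
  have lower: "F h\<^sub>0 \<le> K h\<^sub>0 * pi + arctan_defect (K h\<^sub>0) t"
    using arctan_defect_bounds(1)[OF K1, of t h\<^sub>0] t by (simp add: F_def w_h0)
  have nz: "sqrt (x\<^sup>2 - s\<^sup>2) \<noteq> 0" if "x \<in> {h\<^sub>0..h\<^sub>1}" for x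
    using sq[of x] that by simp
  have "continuous_on {h\<^sub>0..h\<^sub>1} F"
    unfolding F_def[abs_def] arctan_defect_def K_def w_def
    by (intro continuous_intros ballI nz)
  then obtain h where hh: "h\<^sub>0 \<le> h" "h \<le> h\<^sub>1" "F h = K h\<^sub>0 * pi + arctan_defect (K h\<^sub>0) t"
    using IVT'[OF lower upper h01(1)] by blast
  have short: "h * (pi - arctan (w h)) < h\<^sub>0 * (pi + arctan t)"
  proof -
    have "h * (pi - arctan (w h)) < h * pi"
      using w_pos[OF hh(1)] hh(1) h by simp
    also have "\<dots> \<le> h\<^sub>1 * pi" using hh(2) by simp
    also have "\<dots> = h\<^sub>0 * (pi + pi / 4 * (t / 2))"
      by (simp add: h\<^sub>1_def algebra_simps)
    also have "\<dots> \<le> h\<^sub>0 * (pi + arctan t)"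
    proof -
      have "pi / 4 * (t / 2) \<le> 1 * (t / 2)" using t pi_less_4 by (intro mult_right_mono) auto
      then have "pi / 4 * (t / 2) \<le> arctan t" using arctan_ge_half[of t] t by linarith
      then show ?thesis using h by (intro mult_left_mono add_left_mono) auto
    qed
    finally show ?thesis .
  qed
  show ?thesis
    using that[of h "w h"] hh h w_pos[OF hh(1)] w_sin[OF hh(1)] short
    by (simp add: F_def K_def s_def)
qed

text \<open>The polar form of \<open>p\<close>: its modulus depends only on \<open>h sin \<theta>\<close>, hence only on \<open>|q|\<close>, as
  \<open>|p|\<^sup>2 = 1 + |q|\<^sup>2\<close> expresses that the determinant is one.\<close>

lemma Complex_cos_sin_arctan:
  assumes "k\<^sup>2 = 1 + h\<^sup>2"
  shows "Complex (cos (arctan x)) (k * sin (arctan x))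
    = of_real (sqrt (1 + (h * sin (arctan x))\<^sup>2)) * cis (arctan (k * x))"
proof -
  have pos: "1 + y\<^sup>2 > 0" for y :: real by (intro add_pos_nonneg) auto
  have "1 + (h * sin (arctan x))\<^sup>2 = (1 + (k * x)\<^sup>2) / (1 + x\<^sup>2)"
    using pos[of x]
    by (simp add: sin_arctan power_mult_distrib power_divide assms field_simps)
  then have "sqrt (1 + (h * sin (arctan x))\<^sup>2) = sqrt (1 + (k * x)\<^sup>2) / sqrt (1 + x\<^sup>2)"
    by (simp add: real_sqrt_divide)
  then show ?thesis
    using pos[of "k * x"] by (simp add: complex_eq_iff cos_arctan sin_arctan)
qed

text \<open>The hypothesis \<open>chord\<close> makes the values of \<open>|q|\<close> agree, and therefore those of \<open>|p|\<close>. The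
  hypothesis \<open>phase\<close> makes the arguments of \<open>p\<close> agree. What is left is the argument of \<open>q\<close>,
  which a turn of \<open>\<alpha>\<close> corrects.\<close>

lemma geodesics_meet:
  assumes geo0: "orthogonal_geodesic \<alpha> n h\<^sub>0 k\<^sub>0" and h: "0 < h" "k\<^sup>2 = 1 + h\<^sup>2"
    and chord: "h * sin (arctan t') = h\<^sub>0 * sin (arctan t)"
    and phase: "k * pi - arctan_defect k t' = k\<^sub>0 * pi + arctan_defect k\<^sub>0 t"
  obtains \<alpha>' where "norm \<alpha>' = 1" "\<alpha>' \<bullet> n = 0"
    "sr_geodesic \<alpha>' ((k / h) *\<^sub>R n) (2 * h * (pi - arctan t'))
      = sr_geodesic \<alpha> ((k\<^sub>0 / h\<^sub>0) *\<^sub>R n) (2 * h\<^sub>0 * (pi + arctan t))"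
proof -
  interpret g0: orthogonal_geodesic \<alpha> n h\<^sub>0 k\<^sub>0 by (rule geo0)
  define \<tau> \<tau>\<^sub>0 where "\<tau> = pi - arctan t'" and "\<tau>\<^sub>0 = pi + arctan t"
  define r where "r = sqrt (1 + (h\<^sub>0 * sin (arctan t))\<^sup>2)"
  \<comment> \<open>The summand \<open>\<pi>\<close> compensates the opposite signs of \<open>sin \<tau>\<close> and \<open>sin \<tau>\<^sub>0\<close>.\<close>
  define \<phi> where "\<phi> = pi - k\<^sub>0 * \<tau>\<^sub>0 + k * \<tau>"
  define \<alpha>' where "\<alpha>' = rotate_about n \<phi> \<alpha>"
  have \<alpha>': "norm \<alpha>' = 1" "\<alpha>' \<bullet> n = 0"
    unfolding \<alpha>'_def by (rule rotate_about_orthonormal[OF g0.unit g0.orth])+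
  interpret g: orthogonal_geodesic \<alpha>' n h k
    using \<alpha>' g0.unit h by unfold_locales
  have "Complex (cos \<tau>\<^sub>0) (k\<^sub>0 * sin \<tau>\<^sub>0) = - (of_real r * cis (arctan (k\<^sub>0 * t)))"
    unfolding r_def Complex_cos_sin_arctan[OF g0.k, symmetric]
    by (simp add: \<tau>\<^sub>0_def complex_eq_iff)
  then have p0: "Complex (cos \<tau>\<^sub>0) (k\<^sub>0 * sin \<tau>\<^sub>0) * cis (- k\<^sub>0 * \<tau>\<^sub>0)
      = - (of_real r * cis (- (k\<^sub>0 * pi + arctan_defect k\<^sub>0 t)))"
    by (simp add: mult.assoc cis_mult \<tau>\<^sub>0_def arctan_defect_def algebra_simps)
  have "Complex (cos \<tau>) (k * sin \<tau>) = - cnj (Complex (cos (arctan t')) (k * sin (arctan t')))"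
    by (simp add: \<tau>_def complex_eq_iff)
  also have "\<dots> = - (of_real r * cis (- arctan (k * t')))"
    unfolding r_def chord[symmetric] Complex_cos_sin_arctan[OF h(2)] by (simp add: cis_cnj)
  finally have p: "Complex (cos \<tau>) (k * sin \<tau>) * cis (- k * \<tau>)
      = - (of_real r * cis (- (k * pi - arctan_defect k t')))"
    by (simp add: mult.assoc cis_mult \<tau>_def arctan_defect_def algebra_simps)
  have q: "cis \<phi> * ((h * sin \<tau>) *\<^sub>R cis (- k * \<tau>)) = (h\<^sub>0 * sin \<tau>\<^sub>0) *\<^sub>R cis (- k\<^sub>0 * \<tau>\<^sub>0)"
  proof -
    have "cis \<phi> * ((h * sin \<tau>) *\<^sub>R cis (- k * \<tau>)) = (h * sin \<tau>) *\<^sub>R cis (pi + - k\<^sub>0 * \<tau>\<^sub>0)"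
      by (simp add: cis_mult \<phi>_def)
    also have "\<dots> = - ((h * sin \<tau>) *\<^sub>R cis (- k\<^sub>0 * \<tau>\<^sub>0))"
      by (simp only: cis_mult[symmetric] cis_pi) simp
    also have "\<dots> = (- (h * sin \<tau>)) *\<^sub>R cis (- k\<^sub>0 * \<tau>\<^sub>0)"
      by (rule scaleR_minus_left[symmetric])
    also have "- (h * sin \<tau>) = h\<^sub>0 * sin \<tau>\<^sub>0"
      using chord by (simp add: \<tau>_def \<tau>\<^sub>0_def)
    finally show ?thesis .
  qed
  have "g.geo (2 * h * \<tau>) = g0.geo (2 * h\<^sub>0 * \<tau>\<^sub>0)"
    unfolding g.geo_closed_form g0.geo_closed_form p p0 phase q[symmetric]
    by (simp add: \<alpha>'_def pauli_rotate_about[OF g0.orth]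
        complex_mat_mult[OF ipauli_squared[OF g0.unit(2)]] flip: matrix_mul_assoc)
  then show ?thesis using that \<alpha>' by (simp add: \<tau>_def \<tau>\<^sub>0_def)
qed

theorem proposition11:
  fixes \<alpha> \<beta> :: "real^3" and T :: real
  assumes "norm \<alpha> = 1"
    and "norm \<beta> > 1"
    and "\<alpha> \<bullet> \<beta> = 0"
    and "shortest_arc (sr_geodesic \<alpha> \<beta>) 0 T"
  shows "T \<le> 2 * pi / sqrt ((norm \<beta>)\<^sup>2 - 1)"
proof (rule ccontr)
  define h\<^sub>0 where "h\<^sub>0 = 1 / sqrt ((norm \<beta>)\<^sup>2 - 1)"
  define k\<^sub>0 where "k\<^sub>0 = sqrt (1 + h\<^sub>0\<^sup>2)"
  define n where "n = \<beta> /\<^sub>R norm \<beta>"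
  assume "\<not> T \<le> 2 * pi / sqrt ((norm \<beta>)\<^sup>2 - 1)"
  then have T: "2 * h\<^sub>0 * pi < T" by (simp add: h\<^sub>0_def)
  have "norm \<beta> \<noteq> 0" using assms(2) by linarith
  have b: "(norm \<beta>)\<^sup>2 > 1" using assms(2) by (simp add: one_less_power)
  then have h0: "0 < h\<^sub>0" by (simp add: h\<^sub>0_def)
  have "1 + h\<^sub>0\<^sup>2 = (norm \<beta> * h\<^sub>0)\<^sup>2"
    using b by (simp add: h\<^sub>0_def power_divide power_mult_distrib field_simps)
  then have "k\<^sub>0 = norm \<beta> * h\<^sub>0" using h0 by (simp add: k\<^sub>0_def)
  with \<open>norm \<beta> \<noteq> 0\<close> have \<beta>: "\<beta> = (k\<^sub>0 / h\<^sub>0) *\<^sub>R n" using h0 by (simp add: n_def)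
  interpret g0: orthogonal_geodesic \<alpha> n h\<^sub>0 k\<^sub>0
    using assms h0 by unfold_locales (use \<open>norm \<beta> \<noteq> 0\<close> in \<open>auto simp: n_def k\<^sub>0_def\<close>)
  define M where "M = sqrt (1 + 4 * h\<^sub>0\<^sup>2)"
  \<comment> \<open>The margin for the overshoot \<open>arctan t\<close> that keeps the meeting point strictly before time \<open>T\<close>.\<close>
  define \<epsilon> where "\<epsilon> = T / (2 * h\<^sub>0) - pi"
  define t where "t = min (min 1 (h\<^sub>0 / (2 * M\<^sup>2))) (\<epsilon> / 2)"
  have M: "M\<^sup>2 > 0" unfolding M_def by (simp add: add_pos_nonneg)
  have \<epsilon>: "0 < \<epsilon>" using T h0 by (simp add: \<epsilon>_def field_simps)
  have t: "0 < t" "t \<le> 1" "t \<le> h\<^sub>0 / (2 * M\<^sup>2)" "t < \<epsilon>"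
    using \<epsilon> h0 M by (auto simp: t_def min_less_iff_disj)
  obtain h t' where h: "0 < h" "0 < t'"
    and chord: "h * sin (arctan t') = h\<^sub>0 * sin (arctan t)"
    and phase: "sqrt (1 + h\<^sup>2) * pi - arctan_defect (sqrt (1 + h\<^sup>2)) t'
      = k\<^sub>0 * pi + arctan_defect k\<^sub>0 t"
    and shorter: "h * (pi - arctan t') < h\<^sub>0 * (pi + arctan t)"
    using compensating_parameter[OF h0 t(1,2)] t(3) unfolding M_def k\<^sub>0_def by metis
  define k where "k = sqrt (1 + h\<^sup>2)"
  have k: "k\<^sup>2 = 1 + h\<^sup>2" by (simp add: k_def)
  define L L\<^sub>0 where "L = 2 * h * (pi - arctan t')" and "L\<^sub>0 = 2 * h\<^sub>0 * (pi + arctan t)"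
  obtain \<alpha>' where \<alpha>': "norm \<alpha>' = 1" "\<alpha>' \<bullet> n = 0"
    and meet: "sr_geodesic \<alpha>' ((k / h) *\<^sub>R n) L = g0.geo L\<^sub>0"
    using geodesics_meet[OF g0.orthogonal_geodesic_axioms h(1) k chord] phase
    unfolding k_def L_def L\<^sub>0_def by metis
  interpret g: orthogonal_geodesic \<alpha>' n h k
    using \<alpha>' g0.unit h k by unfold_locales
  have "arctan t' < pi" using arctan_ubound[of t'] pi_gt_zero by linarith
  then have "0 < L" using h by (simp add: L_def)
  have "arctan t \<le> t" using t(1) arctan_le_self[of t] by simp
  then have "L\<^sub>0 < 2 * h\<^sub>0 * (pi + \<epsilon>)" unfolding L\<^sub>0_def using t h0 by (intro mult_strict_left_mono) auto
  then have "L\<^sub>0 < T" using h0 by (simp add: \<epsilon>_def)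
  let ?u = "\<lambda>t. if t \<le> L then g.geo_control t else g0.geo_control (t + (L\<^sub>0 - L))"
  let ?\<gamma> = "\<lambda>t. if t \<le> L then g.geo t else g0.geo (t + (L\<^sub>0 - L))"
  have path: "horizontal_path ?\<gamma> ?u 0 (L + (T - L\<^sub>0))"
    by (rule horizontal_path_append[OF meet g.horizontal_path_geo g0.horizontal_path_geo]) fact+
  have "control_length ?u 0 (L + (T - L\<^sub>0)) = L + (T - L\<^sub>0) - 0"
    by (rule control_length_unit_speed[of _ _ "{}"])
      (use \<open>0 < L\<close> \<open>L\<^sub>0 < T\<close> g.H0_inner_geo_control g0.H0_inner_geo_control in auto)
  moreover have "?\<gamma> 0 = g0.geo 0"
    using \<open>0 < L\<close> g.geo_closed_form[of 0] g0.geo_closed_form[of 0] by (simp add: complex_mat_def flip: Complex_eq_0)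
  moreover have "?\<gamma> (L + (T - L\<^sub>0)) = g0.geo T" using \<open>L\<^sub>0 < T\<close> by simp
  ultimately have "sr_dist (g0.geo 0) (g0.geo T) \<le> L + (T - L\<^sub>0)"
    using sr_dist_le_control_length[OF path] by simp
  moreover have "sr_dist (g0.geo 0) (g0.geo T) = T"
    using assms(4) g0.control_length_geo unfolding shortest_arc_def \<beta> by fastforce
  ultimately show False using shorter by (simp add: L_def L\<^sub>0_def)
qed

end
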